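(* Let $\bar h_1$ and $\bar h_2$ be two nonnegative, not identically zero functions in $C^1(\mathbb{R})\cap L^1(\mathbb{R};e^{\alpha x}dx)$, each of which is a solution $\bar h$ of $$0=\partial_x\bar h(x)+\alpha\bar h(x)+e^{-\alpha}\bar h^2(x-1)-\bar h^2(x),\qquad x\in\mathbb{R}.$$ Then there exists $\Lambda\in\mathbb{R}$ such that $\bar h_1(x)=\bar h_2(x-\Lambda)$ for all $x\in\mathbb{R}$.
   Context: Here $\gamma<1$ and $\alpha:=(1-\gamma)\ln 2>0$; $L^1(\mathbb{R};e^{\alpha x}dx)$ is the space of measurable functions $f$ with $\int_{\mathbb{R}}e^{\alpha x}|f(x)|\,dx<\infty$. *)

theory Defs
  imports "HOL-Analysis.Analysis"
begin

definition weighted_L1 :: "real \<Rightarrow> (real \<Rightarrow> real) set" where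
  "weighted_L1 \<alpha> = {f. f \<in> borel_measurable lebesgue \<and>
     (\<integral>\<^sup>+ x. ennreal (exp (\<alpha> * x) * \<bar>f x\<bar>) \<partial>lebesgue) < \<infinity>}"

text \<open>The derivative is taken with \<^const>\<open>deriv\<close>, which is meaningful only for
  differentiable functions; use this predicate together with a \<open>C\<^sup>1\<close> hypothesis.\<close>

definition solves_profile_eq :: "real \<Rightarrow> (real \<Rightarrow> real) \<Rightarrow> bool" where
  "solves_profile_eq \<alpha> h \<longleftrightarrow>
     (\<forall>x. 0 = deriv h x + \<alpha> * h x + exp (- \<alpha>) * (h (x - 1))\<^sup>2 - (h x)\<^sup>2)"

end

theory Submission
  imports Defs "HOL-Real_Asymp.Real_Asymp"
begin

text \<open>Put \<open>u x = exp (\<alpha> * x) * h x\<close>. The profile equation becomes the balance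
  \<open>u' x = G x - G (x - 1)\<close> with the flux \<open>G x = exp (- \<alpha> * x) * (u x)\<^sup>2\<close>. This is the
  equation of a steady state of a transport process in which the flux is an increasing function
  of \<open>u \<ge> 0\<close>; such a process contracts the \<open>L\<^sup>1\<close> distance, and two steady states must be
  cases of equality in the contraction.

  The balance says that \<open>u x\<close> and the integral of \<open>G\<close> over \<open>[x - 1, x]\<close> differ by a constant. The
  constant is 0 (\<open>flux_profile_eq_flux_increment\<close>), because both terms become small at
  \<open>+\<infinity>\<close>, the second since \<open>u\<close> stays bounded there and \<open>\<alpha> > 0\<close>.

  For two solutions \<open>u, v\<close> write \<open>w = u - v\<close> and let \<open>g\<close> be the difference of the fluxes; \<open>g\<close> has the
  sign of \<open>w\<close>, as \<open>g = k * w\<close> with \<open>k \<ge> 0\<close>. Let \<open>H x\<close> be the integral of \<open>\<bar>g\<bar>\<close> over \<open>[x - 1, x]\<close>.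
  Then \<open>\<bar>w\<bar> \<le> H\<close>, since \<open>w x\<close> is the integral of \<open>g\<close> over the same interval, and the defect
  \<open>H - \<bar>w\<bar>\<close> is nonincreasing, since formally its derivative is
  \<open>sgn (w x) * g (x - 1) - \<bar>g (x - 1)\<bar>\<close>. It is at most \<open>u + v\<close>, which takes arbitrarily small values
  near \<open>-\<infinity>\<close> by integrability. Hence the defect vanishes (\<open>abs_difference_eq_increment\<close>).

  The identity \<open>\<bar>w\<bar> = H\<close> shows that \<open>\<bar>w\<bar>\<close> is differentiable with \<open>\<bar>w\<bar>' \<le> k * \<bar>w\<bar>\<close>. By Gronwall's
  argument a zero of \<open>w\<close> forces \<open>w = 0\<close> to the right of it, so \<open>w\<close> cannot change sign
  (\<open>flux_profiles_ordered\<close>). Two ordered solutions with the same integral coincide. Finally,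
  translating \<open>h\<close> by \<open>l\<close> multiplies the integral of \<open>u\<close> by \<open>exp (\<alpha> * l)\<close>, so a translation makes
  the two integrals equal.\<close>

section \<open>Profiles in flux form\<close>

definition flux :: "real \<Rightarrow> (real \<Rightarrow> real) \<Rightarrow> real \<Rightarrow> real" where
  "flux \<alpha> u x = exp (- \<alpha> * x) * (u x)\<^sup>2"

definition flux_profile :: "real \<Rightarrow> (real \<Rightarrow> real) \<Rightarrow> bool" where
  "flux_profile \<alpha> u \<longleftrightarrow> (\<forall>x. 0 \<le> u x) \<and> integrable lborel u \<and>
     (\<forall>x. (u has_real_derivative flux \<alpha> u x - flux \<alpha> u (x - 1)) (at x))"

lemma flux_profileD:
  assumes "flux_profile \<alpha> u"
  shows flux_profile_nonneg: "0 \<le> u x"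
    and flux_profile_integrable: "integrable lborel u"
    and flux_profile_deriv: "(u has_real_derivative flux \<alpha> u x - flux \<alpha> u (x - 1)) (at x)"
  using assms by (simp_all add: flux_profile_def)

lemma flux_profile_continuous: "flux_profile \<alpha> u \<Longrightarrow> continuous_on UNIV u"
  by (rule DERIV_continuous_on[OF flux_profile_deriv])

lemma flux_nonneg: "0 \<le> flux \<alpha> u x"
  by (simp add: flux_def)

lemma flux_continuous: "continuous_on UNIV u \<Longrightarrow> continuous_on UNIV (flux \<alpha> u)"
  unfolding flux_def by (intro continuous_intros)

section \<open>Primitives of continuous functions on the line\<close>

lemma primitive_exists:
  fixes f :: "real \<Rightarrow> real"
  assumes "continuous_on UNIV f"
  obtains F where "\<And>x. (F has_real_derivative f x) (at x)"
proof -
  have "\<exists>F. \<forall>x::real. -\<infinity> < ereal x \<longrightarrow> ereal x < \<infinity> \<longrightarrow> (F has_vector_derivative f x) (at x)"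
    by (rule einterval_antiderivative) (use assms in \<open>auto simp: continuous_on_eq_continuous_at\<close>)
  then show ?thesis
    using that by (auto simp: has_real_derivative_iff_has_vector_derivative)
qed

lemma primitive_increment_le_integral:
  fixes u U :: "real \<Rightarrow> real"
  assumes nonneg: "\<And>x. 0 \<le> u x" and int: "integrable lborel u"
    and cont: "continuous_on UNIV u"
    and U: "\<And>x. (U has_real_derivative u x) (at x)" and "a \<le> b"
  shows "U b - U a \<le> integral\<^sup>L lborel u"
proof -
  have "has_bochner_integral lborel (\<lambda>x. u x * indicator {a..b} x) (U b - U a)"
    using \<open>a \<le> b\<close> U cont
    by (intro has_bochner_integral_FTC_Icc_real) (auto simp: continuous_on_eq_continuous_at)
  then have "integrable lborel (\<lambda>x. u x * indicator {a..b} x)"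
    and "U b - U a = (\<integral>x. u x * indicator {a..b} x \<partial>lborel)"
    by (simp_all add: has_bochner_integral_iff)
  moreover have "(\<integral>x. u x * indicator {a..b} x \<partial>lborel) \<le> integral\<^sup>L lborel u"
    by (intro integral_mono calculation int) (auto simp: nonneg split: split_indicator)
  ultimately show ?thesis by simp
qed

text \<open>A lower bound \<open>\<epsilon> > 0\<close> on a left half-line would make the increments of a primitive unbounded.
  Integrability gives no pointwise decay at \<open>-\<infinity>\<close>; points with small values take its place.\<close>

lemma small_value_left:
  fixes u :: "real \<Rightarrow> real"
  assumes nonneg: "\<And>x. 0 \<le> u x" and int: "integrable lborel u"
    and cont: "continuous_on UNIV u" and "0 < \<epsilon>"
  obtains y where "y \<le> a" "u y < \<epsilon>"
proof (rule ccontr)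
  assume "\<not> thesis"
  with that have large: "\<epsilon> \<le> u y" if "y \<le> a" for y
    using \<open>y \<le> a\<close> by force
  obtain U where U: "\<And>x. (U has_real_derivative u x) (at x)"
    using primitive_exists[OF cont] by blast
  define I where "I = integral\<^sup>L lborel u"
  have "0 \<le> I" unfolding I_def by (simp add: nonneg)
  \<comment> \<open>On \<open>[b, a]\<close> the integral would be at least \<open>\<epsilon> * (a - b) = I + 1\<close>.\<close>
  define b where "b = a - (I + 1) / \<epsilon>"
  have "b \<le> a" using \<open>0 \<le> I\<close> \<open>0 < \<epsilon>\<close> by (simp add: b_def)
  have "U b - \<epsilon> * b \<le> U a - \<epsilon> * a"
    by (rule DERIV_nonneg_imp_nondecreasing[OF \<open>b \<le> a\<close>])
       (auto intro!: exI derivative_eq_intros U simp: large)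
  moreover have "U a - U b \<le> I"
    unfolding I_def by (rule primitive_increment_le_integral[OF nonneg int cont U \<open>b \<le> a\<close>])
  ultimately have "\<epsilon> * (a - b) \<le> I" by (simp add: algebra_simps)
  then show False using \<open>0 < \<epsilon>\<close> by (simp add: b_def)
qed

section \<open>The conserved quantity\<close>

text \<open>For \<open>x \<ge> 0\<close> the weight \<open>exp (- \<alpha> * x)\<close> is at most 1, so \<open>u' \<le> u\<^sup>2 = u * u\<close>. Reading one factor \<open>u\<close>
  as an integrable coefficient turns this quadratic inequality into a linear one, and Gronwall's
  inequality bounds \<open>u\<close> by \<open>u 0 * exp (\<integral>u)\<close>.\<close>

lemma flux_profile_bounded_right:
  assumes "0 < \<alpha>" and u: "flux_profile \<alpha> u"
  obtains M where "\<And>x. 0 \<le> x \<Longrightarrow> u x \<le> M"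
proof -
  note nonneg = flux_profile_nonneg[OF u]
  obtain U where U: "\<And>x. (U has_real_derivative u x) (at x)"
    using primitive_exists[OF flux_profile_continuous[OF u]] by blast
  define I where "I = integral\<^sup>L lborel u"
  have "u x \<le> u 0 * exp I" if "0 \<le> x" for x
  proof -
    have "u x * exp (- U x) \<le> u 0 * exp (- U 0)"
    proof (rule DERIV_nonpos_imp_nonincreasing[OF \<open>0 \<le> x\<close>], intro exI conjI)
      fix t :: real
      assume "0 \<le> t"
      show "((\<lambda>t. u t * exp (- U t)) has_real_derivative
        (flux \<alpha> u t - flux \<alpha> u (t - 1) - (u t)\<^sup>2) * exp (- U t)) (at t)"
        by (auto intro!: derivative_eq_intros U flux_profile_deriv[OF u]
              simp: algebra_simps power2_eq_square)
      have "exp (- \<alpha> * t) \<le> 1" using \<open>0 < \<alpha>\<close> \<open>0 \<le> t\<close> by simp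
      then have "flux \<alpha> u t \<le> 1 * (u t)\<^sup>2"
        unfolding flux_def by (rule mult_right_mono) simp
      then show "(flux \<alpha> u t - flux \<alpha> u (t - 1) - (u t)\<^sup>2) * exp (- U t) \<le> 0"
        using flux_nonneg[of \<alpha> u "t - 1"] by (simp add: mult_le_0_iff)
    qed
    then have "u x * exp (- U x) * exp (U x) \<le> u 0 * exp (- U 0) * exp (U x)"
      by (rule mult_right_mono) simp
    then have "u x \<le> u 0 * exp (U x - U 0)"
      by (simp add: mult.assoc flip: exp_add)
    also have "\<dots> \<le> u 0 * exp I"
    proof -
      have "U x - U 0 \<le> I"
        unfolding I_def
        by (rule primitive_increment_le_integral[OF nonneg flux_profile_integrable[OF u]
              flux_profile_continuous[OF u] U \<open>0 \<le> x\<close>])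
      then show ?thesis by (simp add: mult_left_mono nonneg)
    qed
    finally show ?thesis .
  qed
  then show thesis by (rule that)
qed

text \<open>The balance makes \<open>c = u x - (P x - P (x - 1))\<close> independent of \<open>x\<close>. Boundedness of \<open>u\<close> on the
  right half-line gives \<open>P x - P (x - 1) = O(exp (- \<alpha> * x))\<close>, so \<open>u\<close> tends to \<open>c\<close> at \<open>+\<infinity>\<close> and
  \<open>c \<ge> 0\<close>. A positive \<open>c\<close> would be a lower bound of \<open>u\<close> everywhere, against integrability.\<close>

lemma flux_profile_eq_flux_increment:
  assumes "0 < \<alpha>" and u: "flux_profile \<alpha> u"
    and P: "\<And>x. (P has_real_derivative flux \<alpha> u x) (at x)"
  shows "u x = P x - P (x - 1)"
proof -
  define d where "d x = P x - P (x - 1)" for x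
  have d_nonneg: "0 \<le> d x" for x
  proof -
    have "P (x - 1) \<le> P x"
      by (rule DERIV_nonneg_imp_nondecreasing) (auto intro!: exI P flux_nonneg)
    then show ?thesis by (simp add: d_def)
  qed
  have "((\<lambda>x. P (x - 1)) has_real_derivative flux \<alpha> u (x - 1)) (at x)" for x
    using P[of "x - 1"] DERIV_shift[of P "flux \<alpha> u (x - 1)" x "-1"] by simp
  then have "((\<lambda>x. u x - d x) has_real_derivative 0) (at x)" for x
    unfolding d_def
    by (auto intro!: derivative_eq_intros flux_profile_deriv[OF u] P)
  then have "u x - d x = u 0 - d 0" for x
    by (intro DERIV_isconst_all) blast
  then obtain c where c: "\<And>x. u x = d x + c"
    by (metis add.commute diff_add_cancel)
  obtain M where M: "\<And>x. 0 \<le> x \<Longrightarrow> u x \<le> M"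
    using flux_profile_bounded_right[OF assms(1) u] by blast
  have d_le: "d x \<le> M\<^sup>2 * exp (- \<alpha> * (x - 1))" if "1 \<le> x" for x
  proof -
    define C where "C = M\<^sup>2 * exp (- \<alpha> * (x - 1))"
    have "P x - C * x \<le> P (x - 1) - C * (x - 1)"
    proof (rule DERIV_nonpos_imp_nonincreasing, simp, intro exI conjI)
      fix t assume t: "x - 1 \<le> t"
      show "((\<lambda>t. P t - C * t) has_real_derivative flux \<alpha> u t - C) (at t)"
        by (auto intro!: derivative_eq_intros P)
      have "(u t)\<^sup>2 \<le> M\<^sup>2"
        using M[of t] t that flux_profile_nonneg[OF u] by (intro power_mono) auto
      moreover have "exp (- \<alpha> * t) \<le> exp (- \<alpha> * (x - 1))"
        using t \<open>0 < \<alpha>\<close> by simp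
      ultimately have "flux \<alpha> u t \<le> C"
        unfolding flux_def C_def by (subst mult.commute, intro mult_mono) auto
      then show "flux \<alpha> u t - C \<le> 0" by simp
    qed
    then show ?thesis by (simp add: d_def C_def algebra_simps)
  qed
  have lim0: "((\<lambda>x. M\<^sup>2 * exp (- \<alpha> * (x - 1))) \<longlongrightarrow> 0) at_top"
    using \<open>0 < \<alpha>\<close> by real_asymp
  have "\<forall>\<^sub>F x in at_top. d x \<le> M\<^sup>2 * exp (- \<alpha> * (x - 1))"
    using eventually_ge_at_top[of 1] by eventually_elim (rule d_le)
  then have "(d \<longlongrightarrow> 0) at_top"
    by (rule tendsto_sandwich[OF _ _ tendsto_const lim0, rotated]) (simp add: d_nonneg)
  then have "((\<lambda>x. d x + c) \<longlongrightarrow> 0 + c) at_top"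
    by (intro tendsto_intros)
  then have lim: "(u \<longlongrightarrow> c) at_top"
    by (simp flip: c)
  have "0 \<le> c"
    by (rule tendsto_lowerbound[OF lim]) (auto simp: flux_profile_nonneg[OF u])
  moreover have "\<not> 0 < c"
  proof
    assume "0 < c"
    have cont: "continuous_on UNIV u" by (rule flux_profile_continuous[OF u])
    obtain y where "u y < c"
      using small_value_left[OF flux_profile_nonneg[OF u] flux_profile_integrable[OF u] cont \<open>0 < c\<close>]
      by blast
    then show False using c[of y] d_nonneg[of y] by simp
  qed
  ultimately have "c = 0" by simp
  then show ?thesis using c[of x] by (simp add: d_def)
qed

section \<open>Two profiles are ordered\<close>

text \<open>This is the case of equality in the \<open>L\<^sup>1\<close> contraction: with \<open>g\<close> the difference of the fluxes, the
  right-hand side is the integral of \<open>\<bar>g\<bar>\<close> over \<open>[y - 1, y]\<close>, while \<open>u y - v y\<close> is the integral of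
  \<open>g\<close> itself. The gap between the two sides decreases in \<open>y\<close> and has arbitrarily small values
  near \<open>-\<infinity>\<close>. Since \<open>\<bar>u - v\<bar>\<close> may fail to be differentiable at the zeros of \<open>u - v\<close>, the decrease
  is first proved with \<open>sqrt ((u - v)\<^sup>2 + \<epsilon>\<^sup>2)\<close> in its place.\<close>

lemma abs_difference_eq_increment:
  assumes "0 < \<alpha>" and u: "flux_profile \<alpha> u" and v: "flux_profile \<alpha> v"
    and Q: "\<And>x. (Q has_real_derivative \<bar>flux \<alpha> u x - flux \<alpha> v x\<bar>) (at x)"
  shows "\<bar>u y - v y\<bar> = Q y - Q (y - 1)"
proof -
  note nonneg = flux_profile_nonneg[OF u] flux_profile_nonneg[OF v]
  note cont = flux_profile_continuous[OF u] flux_profile_continuous[OF v]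
  define w where "w x = u x - v x" for x
  define g where "g x = flux \<alpha> u x - flux \<alpha> v x" for x
  define k where "k x = exp (- \<alpha> * x) * (u x + v x)" for x
  define H where "H x = Q x - Q (x - 1)" for x
  have g: "g x = k x * w x" for x
    by (simp add: g_def k_def w_def flux_def power2_eq_square algebra_simps)
  have k_nonneg: "0 \<le> k x" for x
    using nonneg by (simp add: k_def)
  have "continuous_on UNIV k"
    unfolding k_def by (intro continuous_intros cont)
  then obtain K where K: "\<And>x. (K has_real_derivative k x) (at x)"
    using primitive_exists by blast
  obtain P where P: "\<And>x. (P has_real_derivative flux \<alpha> u x) (at x)"
    using primitive_exists[OF flux_continuous[OF cont(1), of \<alpha>]] by blast
  obtain R where R: "\<And>x. (R has_real_derivative flux \<alpha> v x) (at x)"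
    using primitive_exists[OF flux_continuous[OF cont(2), of \<alpha>]] by blast
  have u_eq: "u x = P x - P (x - 1)" and v_eq: "v x = R x - R (x - 1)" for x
    using flux_profile_eq_flux_increment[OF \<open>0 < \<alpha>\<close> u P]
      flux_profile_eq_flux_increment[OF \<open>0 < \<alpha>\<close> v R] by auto
  have w_deriv: "(w has_real_derivative g x - g (x - 1)) (at x)" for x
    unfolding w_def g_def
    by (auto intro!: derivative_eq_intros flux_profile_deriv[OF u] flux_profile_deriv[OF v])
  have H_deriv: "(H has_real_derivative \<bar>g x\<bar> - \<bar>g (x - 1)\<bar>) (at x)" for x
  proof -
    have "((\<lambda>x. Q (x - 1)) has_real_derivative \<bar>g (x - 1)\<bar>) (at x)"
      using Q[of "x - 1"] DERIV_shift[of Q "\<bar>g (x - 1)\<bar>" x "-1"] by (simp add: g_def)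
    then show ?thesis
      unfolding H_def by (auto intro!: derivative_eq_intros Q simp: g_def)
  qed

  have w_le_H: "\<bar>w x\<bar> \<le> H x" for x
  proof -
    have "(\<lambda>x. Q x - (P x - R x)) (x - 1) \<le> (\<lambda>x. Q x - (P x - R x)) x"
      by (rule DERIV_nonneg_imp_nondecreasing)
         (auto intro!: exI derivative_eq_intros P R Q)
    moreover have "(\<lambda>x. Q x + (P x - R x)) (x - 1) \<le> (\<lambda>x. Q x + (P x - R x)) x"
      by (rule DERIV_nonneg_imp_nondecreasing)
         (auto intro!: exI derivative_eq_intros P R Q)
    ultimately show ?thesis
      by (simp add: w_def H_def u_eq v_eq)
  qed
  have H_le: "H x \<le> u x + v x" for x
  proof -
    have "(\<lambda>x. P x + R x - Q x) (x - 1) \<le> (\<lambda>x. P x + R x - Q x) x"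
    proof (rule DERIV_nonneg_imp_nondecreasing, simp, intro exI conjI)
      fix t
      show "((\<lambda>x. P x + R x - Q x) has_real_derivative
          flux \<alpha> u t + flux \<alpha> v t - \<bar>g t\<bar>) (at t)"
        by (auto intro!: derivative_eq_intros P R Q simp: g_def)
      show "0 \<le> flux \<alpha> u t + flux \<alpha> v t - \<bar>g t\<bar>"
        using flux_nonneg[of \<alpha> u t] flux_nonneg[of \<alpha> v t] by (simp add: g_def)
    qed
    then show ?thesis
      by (simp add: H_def u_eq v_eq)
  qed

  \<comment> \<open>The smoothing costs at most \<open>\<epsilon> * k\<close> in the derivative of the gap, hence the term in \<open>K\<close>;
    the summand \<open>\<epsilon>\<close> comes from \<open>s y \<le> \<bar>w y\<bar> + \<epsilon>\<close>.\<close>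
  have regularised: "H y \<le> \<bar>w y\<bar> + H x + \<epsilon> * (1 + K y - K x)" if "x \<le> y" "0 < \<epsilon>" for x \<epsilon>
  proof -
    define s where "s t = sqrt ((w t)\<^sup>2 + \<epsilon>\<^sup>2)" for t
    have s_pos: "0 < s t" for t
      using \<open>0 < \<epsilon>\<close> by (simp add: s_def add_nonneg_pos)
    have s_ge: "\<bar>w t\<bar> \<le> s t" for t
      by (simp add: s_def real_le_rsqrt)
    have s_le: "s t \<le> \<bar>w t\<bar> + \<epsilon>" for t
      using sqrt_sum_squares_le_sum_abs[of "w t" \<epsilon>] \<open>0 < \<epsilon>\<close> by (simp add: s_def)
    have s_deriv: "(s has_real_derivative w t / s t * (g t - g (t - 1))) (at t)" for t
    proof -
      have "0 < (w t)\<^sup>2 + \<epsilon>\<^sup>2" using \<open>0 < \<epsilon>\<close> by (simp add: add_nonneg_pos)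
      then have "(s has_real_derivative
          2 * w t * (g t - g (t - 1)) * (inverse (s t) / 2)) (at t)"
        unfolding s_def by (auto intro!: derivative_eq_intros w_deriv)
      then show ?thesis
        by (rule DERIV_cong) (use s_pos[of t] in \<open>simp add: divide_simps\<close>)
    qed
    have "(\<lambda>t. H t - s t - \<epsilon> * K t) y \<le> (\<lambda>t. H t - s t - \<epsilon> * K t) x"
    proof (rule DERIV_nonpos_imp_nonincreasing[OF \<open>x \<le> y\<close>], intro exI conjI)
      fix t
      let ?D = "\<bar>g t\<bar> - \<bar>g (t - 1)\<bar> - w t / s t * (g t - g (t - 1)) - \<epsilon> * k t"
      show "((\<lambda>t. H t - s t - \<epsilon> * K t) has_real_derivative ?D) (at t)"
        by (auto intro!: derivative_eq_intros H_deriv s_deriv K)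
      have "w t / s t * g (t - 1) \<le> \<bar>w t / s t\<bar> * \<bar>g (t - 1)\<bar>"
        by (metis abs_ge_self abs_mult)
      also have "\<dots> \<le> 1 * \<bar>g (t - 1)\<bar>"
        using s_ge[of t] s_pos[of t] by (intro mult_right_mono) (auto simp: divide_simps)
      finally have "w t / s t * g (t - 1) \<le> \<bar>g (t - 1)\<bar>" by simp
      moreover have "\<bar>g t\<bar> - w t / s t * g t \<le> \<epsilon> * k t"
      proof -
        have "\<bar>g t\<bar> - w t / s t * g t = k t * (\<bar>w t\<bar> / s t * (s t - \<bar>w t\<bar>))"
          using s_pos[of t] k_nonneg[of t]
          by (simp add: g abs_mult field_simps power2_eq_square)
        also have "\<dots> \<le> k t * (1 * \<epsilon>)"
          using s_ge[of t] s_le[of t] s_pos[of t] k_nonneg[of t] \<open>0 < \<epsilon>\<close>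
          by (intro mult_left_mono mult_mono) (auto simp: divide_simps)
        finally show ?thesis by (simp add: mult.commute)
      qed
      ultimately show "?D \<le> 0" by (simp add: right_diff_distrib)
    qed
    then show ?thesis
      using s_le[of y] s_pos[of x] by (simp add: algebra_simps)
  qed
  have decrease: "H y \<le> \<bar>w y\<bar> + H x" if "x \<le> y" for x
  proof (rule field_le_epsilon)
    fix \<delta> :: real
    assume "0 < \<delta>"
    have "K x \<le> K y"
      by (rule DERIV_nonneg_imp_nondecreasing[OF that]) (auto intro!: exI K k_nonneg)
    \<comment> \<open>The denominator \<open>1 + K y - K x\<close> is at least 1 because \<open>K\<close> is nondecreasing.\<close>
    then show "H y \<le> \<bar>w y\<bar> + H x + \<delta>"
      using regularised[OF that, of "\<delta> / (1 + K y - K x)"] \<open>0 < \<delta>\<close> by simp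
  qed
  have "H y \<le> \<bar>w y\<bar>"
  proof (rule field_le_epsilon)
    fix \<delta> :: real
    assume "0 < \<delta>"
    have "continuous_on UNIV (\<lambda>x. u x + v x)"
      by (intro continuous_intros cont)
    moreover have "integrable lborel (\<lambda>x. u x + v x)"
      using flux_profile_integrable[OF u] flux_profile_integrable[OF v] by simp
    ultimately obtain x where "x \<le> y" "u x + v x < \<delta>"
      using small_value_left[of "\<lambda>x. u x + v x" \<delta> y] nonneg \<open>0 < \<delta>\<close> by auto
    then show "H y \<le> \<bar>w y\<bar> + \<delta>"
      using decrease[of x] H_le[of x] by simp
  qed
  with w_le_H[of y] show ?thesis by (simp add: w_def H_def)
qed

text \<open>By the previous identity \<open>\<bar>u - v\<bar>\<close> is differentiable everywhere, and its derivative
  \<open>k x * \<bar>u x - v x\<bar> - \<bar>g (x - 1)\<bar>\<close> makes \<open>\<bar>u - v\<bar> * exp (- K)\<close> nonincreasing for a primitive \<open>K\<close> of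
  \<open>k\<close>. So \<open>u - v\<close> vanishes to the right of each of its zeros. If it changed sign
  between \<open>a\<close> and \<open>b\<close>, it would have a zero there and would then vanish at \<open>max a b\<close>.\<close>

lemma flux_profiles_ordered:
  assumes "0 < \<alpha>" and u: "flux_profile \<alpha> u" and v: "flux_profile \<alpha> v"
  shows "(\<forall>x. u x \<le> v x) \<or> (\<forall>x. v x \<le> u x)"
proof -
  note nonneg = flux_profile_nonneg[OF u] flux_profile_nonneg[OF v]
  note cont = flux_profile_continuous[OF u] flux_profile_continuous[OF v]
  define g where "g x = flux \<alpha> u x - flux \<alpha> v x" for x
  define k where "k x = exp (- \<alpha> * x) * (u x + v x)" for x
  have g: "\<bar>g x\<bar> = k x * \<bar>u x - v x\<bar>" for x
  proof -
    have "g x = k x * (u x - v x)"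
      by (simp add: g_def k_def flux_def power2_eq_square algebra_simps)
    then show ?thesis using nonneg by (simp add: abs_mult k_def)
  qed
  have "continuous_on UNIV k" "continuous_on UNIV (\<lambda>x. \<bar>g x\<bar>)"
    unfolding k_def g_def by (intro continuous_intros flux_continuous cont)+
  then obtain K Q where K: "\<And>x. (K has_real_derivative k x) (at x)"
    and Q: "\<And>x. (Q has_real_derivative \<bar>g x\<bar>) (at x)"
    using primitive_exists by metis
  have abs_eq: "\<bar>u x - v x\<bar> = Q x - Q (x - 1)" for x
    using abs_difference_eq_increment[OF assms, of Q] Q by (simp add: g_def)
  have Q_shift: "((\<lambda>x. Q (x - 1)) has_real_derivative \<bar>g (x - 1)\<bar>) (at x)" for x
    using Q[of "x - 1"] DERIV_shift[of Q "\<bar>g (x - 1)\<bar>" x "-1"] by simp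
  have decay: "\<bar>u y - v y\<bar> * exp (- K y) \<le> \<bar>u x - v x\<bar> * exp (- K x)" if "x \<le> y" for x y
    unfolding abs_eq
  proof (rule DERIV_nonpos_imp_nonincreasing[OF that], intro exI conjI)
    fix t
    show "((\<lambda>t. (Q t - Q (t - 1)) * exp (- K t)) has_real_derivative
        - \<bar>g (t - 1)\<bar> * exp (- K t)) (at t)"
      by (auto intro!: derivative_eq_intros Q Q_shift K simp: g abs_eq algebra_simps)
  qed simp
  have no_crossing: False if less: "u a < v a" "v b < u b" for a b
  proof -
    obtain z where "z \<le> max a b" "u z - v z = 0"
    proof (cases "a \<le> b")
      case True
      have "\<exists>z\<ge>a. z \<le> b \<and> u z - v z = 0"
        by (rule IVT') (use less True cont in \<open>auto intro!: continuous_intros intro: continuous_on_subset\<close>)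
      then show ?thesis using that by auto
    next
      case False
      have "\<exists>z\<ge>b. z \<le> a \<and> u z - v z = 0"
        by (rule IVT2') (use less False cont in \<open>auto intro!: continuous_intros intro: continuous_on_subset\<close>)
      then show ?thesis using that by auto
    qed
    then show False
      using decay[of z "max a b"] less by (auto simp: max_def mult_le_0_iff split: if_splits)
  qed
  then show ?thesis by (meson not_le)
qed

section \<open>Mass and translations\<close>

lemma continuous_eq_if_le_and_integral_eq:
  fixes u v :: "real \<Rightarrow> real"
  assumes "continuous_on UNIV u" "continuous_on UNIV v"
    and "integrable lborel u" "integrable lborel v"
    and "integral\<^sup>L lborel u = integral\<^sup>L lborel v" and "\<And>x. u x \<le> v x"
  shows "u = v"
proof -
  have "AE x in lborel. v x - u x = 0"
    using assms by (subst integral_nonneg_eq_0_iff_AE[symmetric]) auto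
  then have "AE x in lebesgue. x \<in> {x. v x - u x = 0}"
    by (auto intro: AE_completion)
  moreover have "closed {x. v x - u x = 0}"
    using assms by (intro closed_Collect_eq continuous_intros)
  ultimately have "x \<in> {x. v x - u x = 0}" for x
    by (intro mem_closed_if_AE_lebesgue) auto
  then show ?thesis by (auto simp: fun_eq_iff)
qed

lemma flux_profile_mass_pos:
  assumes u: "flux_profile \<alpha> u" and "u x \<noteq> 0"
  shows "0 < integral\<^sup>L lborel u"
proof -
  have "integral\<^sup>L lborel u \<noteq> 0"
  proof
    assume "integral\<^sup>L lborel u = 0"
    then have "(\<lambda>_. 0) = u"
      by (intro continuous_eq_if_le_and_integral_eq)
         (auto simp: flux_profileD[OF u] flux_profile_continuous[OF u])
    with \<open>u x \<noteq> 0\<close> show False by auto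
  qed
  moreover have "0 \<le> integral\<^sup>L lborel u"
    by (simp add: flux_profile_nonneg[OF u])
  ultimately show ?thesis by simp
qed

lemma flux_profile_unique:
  assumes "0 < \<alpha>" and u: "flux_profile \<alpha> u" and v: "flux_profile \<alpha> v"
    and mass: "integral\<^sup>L lborel u = integral\<^sup>L lborel v"
  shows "u = v"
proof -
  note int = flux_profile_integrable[OF u] flux_profile_integrable[OF v]
  note cont = flux_profile_continuous[OF u] flux_profile_continuous[OF v]
  from flux_profiles_ordered[OF assms(1-3)] show ?thesis
  proof
    assume "\<forall>x. u x \<le> v x"
    with cont int mass show ?thesis by (intro continuous_eq_if_le_and_integral_eq) auto
  next
    assume "\<forall>x. v x \<le> u x"
    with cont int mass have "v = u" by (intro continuous_eq_if_le_and_integral_eq) auto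
    then show ?thesis ..
  qed
qed

text \<open>The function \<open>exp (\<alpha> * l) * u (x - l)\<close> is \<open>exp (\<alpha> * x) * h (x - l)\<close> when \<open>u x = exp (\<alpha> * x) * h x\<close>:
  it represents the translated solution of the original equation, and the prefactor is what
  makes the mass adjustable.\<close>

lemma flux_profile_translate:
  assumes u: "flux_profile \<alpha> u"
  shows "flux_profile \<alpha> (\<lambda>x. exp (\<alpha> * l) * u (x - l))"
    and "(\<integral>x. exp (\<alpha> * l) * u (x - l) \<partial>lborel) = exp (\<alpha> * l) * integral\<^sup>L lborel u"
proof -
  have fl: "flux \<alpha> (\<lambda>x. exp (\<alpha> * l) * u (x - l)) x = exp (\<alpha> * l) * flux \<alpha> u (x - l)" for x
  proof -
    have "exp (- \<alpha> * x) * exp (\<alpha> * l) = exp (- \<alpha> * (x - l))"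
      by (simp add: mult_exp_exp algebra_simps)
    then show ?thesis by (simp add: flux_def power2_eq_square)
  qed
  have "integrable lborel (\<lambda>x. u (x - l))"
    using lborel_integrable_real_affine[OF flux_profile_integrable[OF u], of 1 "- l"] by simp
  moreover have "((\<lambda>x. u (x - l)) has_real_derivative
      flux \<alpha> u (x - l) - flux \<alpha> u (x - l - 1)) (at x)" for x
    using flux_profile_deriv[OF u, of "x - l"] DERIV_shift[of u _ x "- l"] by simp
  then have "((\<lambda>x. exp (\<alpha> * l) * u (x - l)) has_real_derivative
      exp (\<alpha> * l) * (flux \<alpha> u (x - l) - flux \<alpha> u (x - l - 1))) (at x)" for x
    by (rule DERIV_cmult)
  ultimately show "flux_profile \<alpha> (\<lambda>x. exp (\<alpha> * l) * u (x - l))"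
    using flux_profile_nonneg[OF u]
    by (simp add: flux_profile_def fl right_diff_distrib algebra_simps)
  show "(\<integral>x. exp (\<alpha> * l) * u (x - l) \<partial>lborel) = exp (\<alpha> * l) * integral\<^sup>L lborel u"
    using lborel_integral_real_affine[of 1 u "- l"] by simp
qed

section \<open>The uniqueness theorem\<close>

lemma flux_profile_of_solution:
  assumes C1: "h C1_differentiable_on UNIV" and L1: "h \<in> weighted_L1 \<alpha>"
    and nonneg: "\<forall>x. 0 \<le> h x" and sol: "solves_profile_eq \<alpha> h"
  shows "flux_profile \<alpha> (\<lambda>x. exp (\<alpha> * x) * h x)"
proof -
  have h_deriv: "(h has_real_derivative (h x)\<^sup>2 - exp (- \<alpha>) * (h (x - 1))\<^sup>2 - \<alpha> * h x) (at x)" for x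
  proof -
    have "h differentiable at x"
      using C1 by (simp add: C1_differentiable_on_eq)
    then have "(h has_real_derivative deriv h x) (at x)"
      by (simp add: DERIV_deriv_iff_real_differentiable)
    moreover have "deriv h x = (h x)\<^sup>2 - exp (- \<alpha>) * (h (x - 1))\<^sup>2 - \<alpha> * h x"
      using sol[unfolded solves_profile_eq_def, rule_format, of x] by linarith
    ultimately show ?thesis by simp
  qed
  have "continuous_on UNIV h"
    by (rule DERIV_continuous_on[OF h_deriv])
  then have [measurable]: "h \<in> borel_measurable borel"
    by (rule borel_measurable_continuous_onI)
  have norm_finite: "(\<integral>\<^sup>+ x. ennreal (exp (\<alpha> * x) * \<bar>h x\<bar>) \<partial>lborel) < \<infinity>"
    using L1 by (simp add: weighted_L1_def nn_integral_completion)
  have fl: "flux \<alpha> (\<lambda>x. exp (\<alpha> * x) * h x) x = exp (\<alpha> * x) * (h x)\<^sup>2" for x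
  proof -
    have "flux \<alpha> (\<lambda>x. exp (\<alpha> * x) * h x) x = (exp (- \<alpha> * x) * exp (\<alpha> * x)) * exp (\<alpha> * x) * (h x)\<^sup>2"
      unfolding flux_def power2_eq_square by (simp only: ac_simps)
    then show ?thesis by (simp add: mult_exp_exp)
  qed
  have "integrable lborel (\<lambda>x. exp (\<alpha> * x) * h x)"
    using norm_finite by (intro integrableI_bounded) (auto simp: abs_mult)
  moreover have "((\<lambda>x. exp (\<alpha> * x) * h x) has_real_derivative
      flux \<alpha> (\<lambda>x. exp (\<alpha> * x) * h x) x - flux \<alpha> (\<lambda>x. exp (\<alpha> * x) * h x) (x - 1)) (at x)" for x
  proof -
    have "exp (\<alpha> * (x - 1)) = exp (\<alpha> * x) * exp (- \<alpha>)"
      by (simp add: mult_exp_exp right_diff_distrib)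
    then show ?thesis
      unfolding fl by (auto intro!: derivative_eq_intros h_deriv simp: algebra_simps)
  qed
  ultimately show ?thesis
    using nonneg by (simp add: flux_profile_def)
qed

theorem corollary2p4:
  fixes \<gamma> \<alpha> :: real and h\<^sub>1 h\<^sub>2 :: "real \<Rightarrow> real"
  assumes "\<gamma> < 1"
    and "\<alpha> = (1 - \<gamma>) * ln 2"
    and "h\<^sub>1 C1_differentiable_on UNIV" and "h\<^sub>1 \<in> weighted_L1 \<alpha>"
    and "\<forall>x. 0 \<le> h\<^sub>1 x" and "\<exists>x. h\<^sub>1 x \<noteq> 0" and "solves_profile_eq \<alpha> h\<^sub>1"
    and "h\<^sub>2 C1_differentiable_on UNIV" and "h\<^sub>2 \<in> weighted_L1 \<alpha>"
    and "\<forall>x. 0 \<le> h\<^sub>2 x" and "\<exists>x. h\<^sub>2 x \<noteq> 0" and "solves_profile_eq \<alpha> h\<^sub>2"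
  shows "\<exists>\<Lambda>::real. \<forall>x. h\<^sub>1 x = h\<^sub>2 (x - \<Lambda>)"
proof -
  have "0 < \<alpha>" using assms(1,2) by simp
  define u where "u = (\<lambda>x. exp (\<alpha> * x) * h\<^sub>1 x)"
  define v where "v = (\<lambda>x. exp (\<alpha> * x) * h\<^sub>2 x)"
  have u: "flux_profile \<alpha> u" and v: "flux_profile \<alpha> v"
    unfolding u_def v_def
    by (rule flux_profile_of_solution[OF assms(3,4,5,7)] flux_profile_of_solution[OF assms(8,9,10,12)])+
  define m where "m = integral\<^sup>L lborel u"
  define n where "n = integral\<^sup>L lborel v"
  have "0 < m" "0 < n"
    using assms(6,11) flux_profile_mass_pos[OF u] flux_profile_mass_pos[OF v]
    by (auto simp: u_def v_def m_def n_def)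
  \<comment> \<open>The translation that gives \<open>v\<close> the mass of \<open>u\<close>.\<close>
  define l where "l = ln (m / n) / \<alpha>"
  have "exp (\<alpha> * l) * n = m"
    using \<open>0 < m\<close> \<open>0 < n\<close> \<open>0 < \<alpha>\<close> by (simp add: l_def)
  then have mass: "integral\<^sup>L lborel u = (\<integral>x. exp (\<alpha> * l) * v (x - l) \<partial>lborel)"
    unfolding flux_profile_translate(2)[OF v] m_def n_def by (rule sym)
  have uv: "u = (\<lambda>x. exp (\<alpha> * l) * v (x - l))"
    by (rule flux_profile_unique[OF \<open>0 < \<alpha>\<close> u flux_profile_translate(1)[OF v] mass])
  have "h\<^sub>1 x = h\<^sub>2 (x - l)" for x
  proof -
    have "exp (\<alpha> * x) * h\<^sub>1 x = exp (\<alpha> * l) * exp (\<alpha> * (x - l)) * h\<^sub>2 (x - l)"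
      using fun_cong[OF uv, of x] by (simp only: u_def v_def mult.assoc)
    also have "exp (\<alpha> * l) * exp (\<alpha> * (x - l)) = exp (\<alpha> * x)"
      by (simp add: mult_exp_exp right_diff_distrib)
    finally show ?thesis by simp
  qed
  then show ?thesis by auto
qed

end
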